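(* Let $n\ge 1$ and let $r_n>0$ be chosen so that $C_n:=[-r_n,r_n]^n\subseteq\mathbb{R}^n$ has standard Gaussian measure $1/2$. If $P\subseteq\mathbb{R}^n$ is an intersection of $m$ halfspaces, then $$\mathrm{dist}_{\mathrm{G}}(P,C_n)\ge \frac12-\sqrt{\frac{m\ln 2}{2n}}.$$ Consequently, if $\mathrm{dist}_{\mathrm{G}}(P,C_n)\le\varepsilon<1/2$, then $$m\ge \frac{2(1/2-\varepsilon)^2}{\ln 2}\,n.$$
   Context: For measurable $K,L\subseteq\mathbb{R}^n$, $\mathrm{dist}_{\mathrm{G}}(K,L):=\Pr_{g\sim N(0,I_n)}[g\in K\triangle L]$, where $K\triangle L$ is the symmetric difference. *)

theory Defs
  imports "HOL-Probability.Probability"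
begin

definition std_gaussian :: "(real ^ 'n) measure" where
  "std_gaussian = density lborel (\<lambda>x. ennreal (\<Prod>i\<in>UNIV. std_normal_density (x $ i)))"

definition dist_G :: "(real ^ 'n) set \<Rightarrow> (real ^ 'n) set \<Rightarrow> real" where
  "dist_G K L = measure std_gaussian (sym_diff K L)"

definition cube :: "real \<Rightarrow> (real ^ 'n) set" where
  "cube r = {x. \<forall>i. x $ i \<in> {-r..r}}"

(* Both closed and open halfspaces are admitted; the two differ only by a null set. *)
definition is_halfspace :: "(real ^ 'n) set \<Rightarrow> bool" where
  "is_halfspace H \<longleftrightarrow>
     (\<exists>a b. a \<noteq> 0 \<and> (H = {x. a \<bullet> x \<le> b} \<or> H = {x. a \<bullet> x < b}))"

(* Repetitions are allowed, and the intersection of zero halfspaces is the whole space. *)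
definition is_intersection_of_halfspaces :: "nat \<Rightarrow> (real ^ 'n) set \<Rightarrow> bool" where
  "is_intersection_of_halfspaces m P \<longleftrightarrow>
     (\<exists>H. (\<forall>i<m. is_halfspace (H i)) \<and> P = (\<Inter>i<m. H i))"

end

theory Submission
  imports Defs "HOL-Combinatorics.Transposition"
begin

text \<open>
  Let \<open>f\<close> be the indicator of the cube and let \<open>V\<close>, of dimension \<open>d \<le> m\<close>, be the span of the normals
  of the halfspaces, so that membership in \<open>P\<close> depends only on the projection to \<open>V\<close>. The covariance
  of \<open>f\<close> with the indicator of \<open>P\<close> is at most half the standard deviation of \<open>E[f | V]\<close>, and the key
  estimate is \<open>Var E[f | V] \<le> (d / n) Var f\<close>. This yields the lower bound \<open>1/2 - sqrt (m / n) / 2\<close>,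
  which is slightly stronger than the claim because \<open>ln 2 \<ge> 1/2\<close>.

  For a cosine sum \<open>F = \<Sum> w b * cos (b \<bullet> x)\<close>, put \<open>u b = w b * exp (- (b \<bullet> b) / 2)\<close>. Then
  \<open>Var F = \<Sum> u b * u b' * (cosh (b \<bullet> b') - 1)\<close>, while \<open>Var E[F | V]\<close> is the same sum with \<open>b \<bullet> b'\<close>
  replaced by the inner product of the projections \<open>\<pi> b\<close> and \<open>\<pi> b'\<close>. The two are compared
  power by power: by positive definiteness \<open>(\<pi> b \<bullet> \<pi> b')^(k+1)\<close> may be replaced by
  \<open>(\<pi> b \<bullet> \<pi> b') * (b \<bullet> b')^k\<close>, and if \<open>F\<close> is invariant under sign changes and permutations of the
  coordinates, then in the expansion of \<open>\<pi> b \<bullet> \<pi> b'\<close> the off-diagonal terms vanish and the diagonal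
  ones agree, so that the factor \<open>\<pi> b \<bullet> \<pi> b'\<close> averages to \<open>(d / n) (b \<bullet> b')\<close>. The cube is
  finally approximated by products of even trigonometric polynomials.
\<close>

section \<open>Gaussian integrals\<close>

definition gaussian_density :: "real ^ 'n \<Rightarrow> real" where
  "gaussian_density x = (\<Prod>i\<in>UNIV. std_normal_density (x $ i))"

lemma gaussian_density_eq:
  fixes x :: "real ^ 'n"
  shows "gaussian_density x = (1 / sqrt (2 * pi)) ^ CARD('n) * exp (- (x \<bullet> x) / 2)"
proof -
  have "gaussian_density x = (1 / sqrt (2 * pi)) ^ CARD('n) * (\<Prod>i\<in>UNIV. exp (- (x $ i)\<^sup>2 / 2))"
    by (simp add: gaussian_density_def std_normal_density_def prod.distrib prod_dividef power_one_over)
  also have "(\<Prod>i\<in>UNIV. exp (- (x $ i)\<^sup>2 / 2)) = exp (\<Sum>i\<in>UNIV. - (x $ i)\<^sup>2 / 2)"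
    by (simp add: exp_sum)
  also have "(\<Sum>i\<in>UNIV. - (x $ i)\<^sup>2 / 2) = - (x \<bullet> x) / 2"
    by (simp add: inner_vec_def power2_eq_square sum_negf sum_divide_distrib)
  finally show ?thesis .
qed

lemma measurable_gaussian_density [measurable]:
  "(gaussian_density :: real ^ 'n \<Rightarrow> real) \<in> borel_measurable borel"
  unfolding gaussian_density_eq by measurable

lemma gaussian_density_nonneg: "0 \<le> gaussian_density x"
  by (simp add: gaussian_density_def prod_nonneg)

lemma std_gaussian_eq: "std_gaussian = density lborel (\<lambda>x. ennreal (gaussian_density x))"
  by (simp add: std_gaussian_def gaussian_density_def)

lemma sets_std_gaussian [measurable_cong, simp]: "sets std_gaussian = sets borel"
  by (simp add: std_gaussian_def)

lemma space_std_gaussian [simp]: "space std_gaussian = UNIV"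
  by (simp add: std_gaussian_def)

lemma prob_space_std_gaussian: "prob_space (std_gaussian :: (real ^ 'n) measure)"
proof
  have Basis: "(Basis :: (real ^ 'n) set) = (\<lambda>i. axis i 1) ` UNIV"
    by (auto simp: Basis_vec_def)
  have inj: "inj (\<lambda>i::'n. axis i (1::real))"
    by (auto simp: inj_on_def axis_eq_axis)
  have "emeasure (std_gaussian :: (real ^ 'n) measure) (space std_gaussian) =
      (\<integral>\<^sup>+x. ennreal (gaussian_density (x :: real ^ 'n)) \<partial>lborel)"
    by (simp add: std_gaussian_eq emeasure_density)
  also have "\<dots> = (\<integral>\<^sup>+x. (\<Prod>b\<in>Basis. ennreal (std_normal_density ((x :: real ^ 'n) \<bullet> b))) \<partial>lborel)"
    by (simp add: Basis prod.reindex[OF inj] inner_axis prod_ennreal gaussian_density_def)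
  also have "\<dots> = (\<Prod>b\<in>(Basis :: (real ^ 'n) set). \<integral>\<^sup>+x. ennreal (std_normal_density x) \<partial>lborel)"
    by (rule nn_integral_lborel_prod) auto
  also have "(\<integral>\<^sup>+x. ennreal (std_normal_density x) \<partial>lborel) = 1"
    by (simp add: nn_integral_eq_integral integral_normal_density)
  finally show "emeasure (std_gaussian :: (real ^ 'n) measure) (space std_gaussian) = 1"
    by simp
qed

interpretation std_gaussian: prob_space std_gaussian
  by (rule prob_space_std_gaussian)

lemma integrable_std_gaussian_bounded:
  fixes f :: "real ^ 'n \<Rightarrow> real"
  assumes "f \<in> borel_measurable borel" "\<And>x. \<bar>f x\<bar> \<le> K"
  shows "integrable std_gaussian f"
  by (rule std_gaussian.integrable_const_bound[where B = K])
    (use assms in \<open>auto intro!: measurableI dest: measurable_sets\<close>)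

lemma integral_std_gaussian:
  fixes f :: "real ^ 'n \<Rightarrow> real"
  assumes "f \<in> borel_measurable borel"
  shows "integral\<^sup>L std_gaussian f = (\<integral>x. gaussian_density x * f x \<partial>lborel)"
  unfolding std_gaussian_eq using assms
  by (subst integral_density) (auto simp: gaussian_density_nonneg)

lemma integrable_gaussian_density:
  "integrable lborel (gaussian_density :: real ^ 'n \<Rightarrow> real)"
proof -
  have "integrable (std_gaussian :: (real ^ 'n) measure) (\<lambda>_. 1 :: real)"
    by simp
  then show ?thesis
    unfolding std_gaussian_eq by (subst (asm) integrable_density) (auto simp: gaussian_density_nonneg)
qed

section \<open>Integrating out one direction by translation\<close>

lemma integral_lborel_translate:
  fixes f :: "'a::euclidean_space \<Rightarrow> real"
  assumes "f \<in> borel_measurable borel"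
  shows "(\<integral>x. f (x + a) \<partial>lborel) = (\<integral>x. f x \<partial>lborel)"
proof -
  have "(\<integral>x. f x \<partial>lborel) = (\<integral>x. f x \<partial>distr lborel borel ((+) a))"
    by (simp only: lborel_distr_plus)
  also have "\<dots> = (\<integral>x. f (a + x) \<partial>lborel)"
    using assms by (subst integral_distr) auto
  finally show ?thesis by (simp add: add.commute)
qed

text \<open>As \<open>c\<close> is a unit vector, moving \<open>x\<close> by
  \<open>s *\<^sub>R c\<close> adds \<open>2 * s * (c \<bullet> x) + s\<^sup>2\<close> to
  \<open>x \<bullet> x\<close>, which is also what \<open>(c \<bullet> x)\<^sup>2\<close> gains when
  \<open>s\<close> is added to \<open>c \<bullet> x\<close>.\<close>

lemma gaussian_density_shift:
  fixes c :: "real ^ 'n"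
  assumes "norm c = 1"
  shows "gaussian_density (x + s *\<^sub>R c) * std_normal_density (c \<bullet> x)
       = gaussian_density x * std_normal_density (c \<bullet> x + s)"
proof -
  have cc: "c \<bullet> c = 1" using assms by (simp add: norm_eq_1)
  have "exp (- ((x + s *\<^sub>R c) \<bullet> (x + s *\<^sub>R c)) / 2) * exp (- (c \<bullet> x)\<^sup>2 / 2)
      = exp (- (x \<bullet> x) / 2) * exp (- (c \<bullet> x + s)\<^sup>2 / 2)"
    unfolding exp_add[symmetric]
    by (rule arg_cong[where f = exp])
      (simp add: inner_add_left inner_add_right cc inner_commute[of x c] power2_eq_square field_simps)
  then show ?thesis
    by (simp add: gaussian_density_eq std_normal_density_def field_simps)
qed

text \<open>For fixed \<open>x\<close> the factor in \<open>s\<close> integrates to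
  \<open>1 / \<bar>u\<bar>\<close>, so \<open>K\<close> times the product of the two densities is an
  integrable majorant. The cases \<open>u = 1\<close> and \<open>u = -1\<close> justify the two
  Fubini exchanges of the splitting lemma below.\<close>

lemma integrable_gaussian_density_times:
  fixes c :: "real ^ 'n"
  assumes u: "u \<noteq> 0"
    and [measurable]: "(\<lambda>(x, s). G x s) \<in> borel_measurable (lborel \<Otimes>\<^sub>M lborel)"
    and G: "\<And>x s. \<bar>G x s\<bar> \<le> K"
  shows "integrable (lborel \<Otimes>\<^sub>M lborel)
    (\<lambda>(x, s). gaussian_density x * G x s * std_normal_density (c \<bullet> x + u * s))"
proof -
  let ?p = "gaussian_density :: real ^ 'n \<Rightarrow> real" and ?q = std_normal_density
  have K: "0 \<le> K" using G[of 0 0] by auto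
  have q: "(\<integral>s. ?q (a + u * s) \<partial>lborel) = 1 / \<bar>u\<bar>" "integrable lborel (\<lambda>s. ?q (a + u * s))" for a
    using lborel_integral_real_affine[OF u, of ?q a] lborel_integrable_real_affine[of ?q u a] u
    by (simp_all add: field_simps)
  have "integrable (lborel \<Otimes>\<^sub>M lborel) (\<lambda>(x, s). ?p x * ?q (c \<bullet> x + u * s))"
  proof (rule lborel_pair.Fubini_integrable)
    show "(\<lambda>(x, s). ?p x * ?q (c \<bullet> x + u * s)) \<in> borel_measurable (lborel \<Otimes>\<^sub>M lborel)"
      unfolding gaussian_density_eq by measurable
    show "integrable lborel (\<lambda>x. \<integral>s. norm (case (x, s) of (x, s) \<Rightarrow> ?p x * ?q (c \<bullet> x + u * s)) \<partial>lborel)"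
      using integrable_divide[OF integrable_gaussian_density, of "\<bar>u\<bar>"]
      by (simp add: abs_mult  gaussian_density_nonneg q)
    show "AE x in lborel. integrable lborel (\<lambda>s. case (x, s) of (x, s) \<Rightarrow> ?p x * ?q (c \<bullet> x + u * s))"
      by (simp add: q)
  qed
  from integrable_mult_right[OF this, of K] show ?thesis
  proof (rule Bochner_Integration.integrable_bound)
    show "(\<lambda>(x, s). ?p x * G x s * ?q (c \<bullet> x + u * s)) \<in> borel_measurable (lborel \<Otimes>\<^sub>M lborel)"
      unfolding gaussian_density_eq by measurable
    have "\<bar>?p x * G x s * ?q (c \<bullet> x + u * s)\<bar> \<le> \<bar>K * (?p x * ?q (c \<bullet> x + u * s))\<bar>" for x s
    proof -
      have "\<bar>G x s\<bar> * (?p x * ?q (c \<bullet> x + u * s)) \<le> K * (?p x * ?q (c \<bullet> x + u * s))"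
        by (intro mult_right_mono G) (auto simp: gaussian_density_nonneg)
      then show ?thesis
        using K by (simp add: abs_mult gaussian_density_nonneg mult_ac)
    qed
    then show "AE z in lborel \<Otimes>\<^sub>M lborel. norm (case z of (x, s) \<Rightarrow> ?p x * G x s * ?q (c \<bullet> x + u * s))
        \<le> norm (K * (case z of (x, s) \<Rightarrow> ?p x * ?q (c \<bullet> x + u * s)))"
      by (auto intro!: AE_I2)
  qed
qed

text \<open>
  No rotation invariance is needed: the translation \<open>x \<mapsto> x - s c\<close> in the integral over \<open>x\<close>
  exchanges the roles of \<open>c \<bullet> x\<close> and an auxiliary independent variable \<open>c \<bullet> x + s\<close>.
\<close>
lemma std_gaussian_integral_split:
  fixes c :: "real ^ 'n"
  assumes c: "norm c = 1"
    and [measurable]: "f \<in> borel_measurable borel" "g \<in> borel_measurable borel"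
    and f: "\<And>x. \<bar>f x\<bar> \<le> K" and g: "\<And>t. \<bar>g t\<bar> \<le> L"
    and inv: "\<And>x s. f (x + s *\<^sub>R c) = f x"
  shows "(\<integral>x. f x * g (c \<bullet> x) \<partial>std_gaussian)
       = integral\<^sup>L std_gaussian f * (\<integral>t. std_normal_density t * g t \<partial>lborel)"
proof -
  let ?p = "gaussian_density :: real ^ 'n \<Rightarrow> real" and ?q = std_normal_density
  have cc: "c \<bullet> c = 1" using c by (simp add: norm_eq_1)
  have fg: "\<bar>f x * g t\<bar> \<le> K * L" for x t
    using f[of x] g[of t] f[of 0] by (auto simp: abs_mult intro!: mult_mono)
  \<comment> \<open>The normal density has integral 1 over \<open>s\<close>, so it can be inserted
    freely; \<open>1 * s\<close> is kept to match the integrability lemma with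
    \<open>u = 1\<close>.\<close>
  define J where "J x s = ?p x * (f x * g (c \<bullet> x)) * ?q (c \<bullet> x + 1 * s)" for x s
  have J [measurable]: "(\<lambda>x. J x s) \<in> borel_measurable borel" for s
    unfolding J_def gaussian_density_eq by measurable
  have q_shift: "(\<integral>s. ?q (a + s) \<partial>lborel) = 1" for a
    using integral_lborel_translate[of ?q a] by (simp add: add.commute)
  have flip: "(\<integral>s. ?q (a - s) * g (a - s) \<partial>lborel) = (\<integral>t. ?q t * g t \<partial>lborel)" for a
    using lborel_integral_real_affine[of "-1" "\<lambda>t. ?q t * g t" a] by simp
  have "(\<integral>x. f x * g (c \<bullet> x) \<partial>std_gaussian) = (\<integral>x. (\<integral>s. J x s \<partial>lborel) \<partial>lborel)"
    by (subst integral_std_gaussian) (simp_all add: J_def[abs_def] q_shift mult.assoc[symmetric])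
  also have "\<dots> = (\<integral>s. (\<integral>x. J x s \<partial>lborel) \<partial>lborel)"
    unfolding J_def
    by (rule lborel_pair.Fubini_integral[symmetric], rule integrable_gaussian_density_times[where K = "K * L"])
      (use fg in \<open>auto intro!: borel_measurable_times\<close>)
  also have "\<dots> = (\<integral>s. (\<integral>x. J (x + (-s) *\<^sub>R c) s \<partial>lborel) \<partial>lborel)"
    by (intro Bochner_Integration.integral_cong refl integral_lborel_translate[symmetric] J)
  also have "\<dots> = (\<integral>s. (\<integral>x. ?p x * (f x * g (c \<bullet> x - s)) * ?q (c \<bullet> x + (-1) * s) \<partial>lborel) \<partial>lborel)"
  proof (intro Bochner_Integration.integral_cong refl)
    fix s x
    \<comment> \<open>Moving \<open>x\<close> by \<open>-s\<close> along \<open>c\<close> fixes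
      \<open>f\<close>, turns \<open>c \<bullet> x\<close> into \<open>c \<bullet> x - s\<close>,
      and the density shift passes the displacement on to the normal factor.\<close>
    show "J (x + (-s) *\<^sub>R c) s = ?p x * (f x * g (c \<bullet> x - s)) * ?q (c \<bullet> x + (-1) * s)"
      using gaussian_density_shift[OF c, of x "-s"] inv[of x "-s"]
      by (simp add: J_def inner_diff_right cc mult.commute mult.left_commute)
  qed
  \<comment> \<open>After the second exchange \<open>s\<close> occurs only through
    \<open>c \<bullet> x - s\<close>. Substituting \<open>t\<close> for it makes the inner integral
    constant in \<open>x\<close>, up to the factor \<open>?p x * f x\<close>.\<close>
  also have "\<dots> = (\<integral>x. (\<integral>s. ?p x * (f x * g (c \<bullet> x - s)) * ?q (c \<bullet> x + (-1) * s) \<partial>lborel) \<partial>lborel)"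
    by (rule lborel_pair.Fubini_integral, rule integrable_gaussian_density_times[where K = "K * L"])
      (use fg in \<open>auto\<close>)
  also have "\<dots> = (\<integral>x. ?p x * f x * (\<integral>t. ?q t * g t \<partial>lborel) \<partial>lborel)"
  proof (intro Bochner_Integration.integral_cong refl)
    fix x
    have "(\<integral>s. ?p x * (f x * g (c \<bullet> x - s)) * ?q (c \<bullet> x + (-1) * s) \<partial>lborel)
        = (\<integral>s. (?p x * f x) * (?q (c \<bullet> x - s) * g (c \<bullet> x - s)) \<partial>lborel)"
      by (simp add: ac_simps)
    then show "(\<integral>s. ?p x * (f x * g (c \<bullet> x - s)) * ?q (c \<bullet> x + (-1) * s) \<partial>lborel)
        = ?p x * f x * (\<integral>t. ?q t * g t \<partial>lborel)"
      by (simp add: flip)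
  qed
  finally show ?thesis
    by (simp add: integral_std_gaussian)
qed

text \<open>Real and imaginary part of the characteristic function of the standard normal
  distribution.\<close>

lemma integral_std_normal_cos_sin:
  shows "(\<integral>t. std_normal_density t * cos (u * t) \<partial>lborel) = exp (- u\<^sup>2 / 2)"
    and "(\<integral>t. std_normal_density t * sin (u * t) \<partial>lborel) = 0"
proof -
  interpret real_distribution std_normal_distribution
    by (rule real_dist_normal_dist)
  have int: "complex_integrable std_normal_distribution (\<lambda>x. iexp (u * x))"
    by (rule integrable_iexp) auto
  have "(CLINT x|std_normal_distribution. iexp (u * x)) = complex_of_real (exp (- u\<^sup>2 / 2))"
    using char_std_normal_distribution by (simp add: char_def fun_eq_iff)
  from arg_cong[OF this, of Re] arg_cong[OF this, of Im]
  have "(\<integral>x. cos (u * x) \<partial>std_normal_distribution) = exp (- u\<^sup>2 / 2)"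
    "(\<integral>x. sin (u * x) \<partial>std_normal_distribution) = 0"
    unfolding integral_Re[OF int, symmetric] integral_Im[OF int, symmetric]
    by (simp_all add: Re_exp Im_exp)
  then show "(\<integral>t. std_normal_density t * cos (u * t) \<partial>lborel) = exp (- u\<^sup>2 / 2)"
    "(\<integral>t. std_normal_density t * sin (u * t) \<partial>lborel) = 0"
    by (simp_all add: integral_density)
qed

text \<open>By the addition formula: \<open>p \<bullet> x\<close> and \<open>h\<close> are constant
  along \<open>q\<close>, so the cosine and sine of \<open>q \<bullet> x\<close> integrate out to
  \<open>exp (- (q \<bullet> q) / 2)\<close> and 0. With \<open>p\<close> the projection of a
  frequency to \<open>V\<close> and \<open>q\<close> the rest, this computes the conditional
  expectation of the cosine given \<open>V\<close>.\<close>

lemma std_gaussian_integral_cos_orthogonal: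
  fixes p q :: "real ^ 'n"
  assumes pq: "p \<bullet> q = 0"
    and h [measurable]: "h \<in> borel_measurable borel" and bnd: "\<And>x. \<bar>h x\<bar> \<le> K"
    and inv: "\<And>x s. h (x + s *\<^sub>R q) = h x"
  shows "(\<integral>x. cos ((p + q) \<bullet> x) * h x \<partial>std_gaussian)
       = exp (- (q \<bullet> q) / 2) * (\<integral>x. cos (p \<bullet> x) * h x \<partial>std_gaussian)"
proof (cases "q = 0")
  case False
  define c where "c = q /\<^sub>R norm q"
  have c: "norm c = 1" using False by (simp add: c_def)
  have qc: "q = norm q *\<^sub>R c" using False by (simp add: c_def)
  have pc: "p \<bullet> c = 0" using pq by (simp add: c_def)
  have inv': "h (x + s *\<^sub>R c) = h x" for x s
    using inv[of x "s / norm q"] by (simp add: c_def field_simps)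
  have bd: "\<bar>v * h x\<bar> \<le> K" if "\<bar>v\<bar> \<le> 1" for v x
    using mult_mono[OF that bnd[of x]] by (simp add: abs_mult)
  have bd2: "\<bar>v * h x * w\<bar> \<le> K" if "\<bar>v\<bar> \<le> 1" "\<bar>w\<bar> \<le> 1" for v w x
    using mult_mono[OF bd[OF that(1), of x] that(2)] bnd[of x] by (simp add: abs_mult)
  have "(\<integral>x. cos ((p + q) \<bullet> x) * h x \<partial>std_gaussian)
      = (\<integral>x. cos (p \<bullet> x) * h x * cos (norm q * (c \<bullet> x)) - sin (p \<bullet> x) * h x * sin (norm q * (c \<bullet> x)) \<partial>std_gaussian)"
    by (subst qc) (simp add: inner_add_left cos_add algebra_simps)
  also have "\<dots> = (\<integral>x. cos (p \<bullet> x) * h x * cos (norm q * (c \<bullet> x)) \<partial>std_gaussian)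
      - (\<integral>x. sin (p \<bullet> x) * h x * sin (norm q * (c \<bullet> x)) \<partial>std_gaussian)"
    by (intro Bochner_Integration.integral_diff integrable_std_gaussian_bounded[where K = K] bd2) auto
  also have "(\<integral>x. cos (p \<bullet> x) * h x * cos (norm q * (c \<bullet> x)) \<partial>std_gaussian)
      = (\<integral>x. cos (p \<bullet> x) * h x \<partial>std_gaussian) * exp (- (norm q)\<^sup>2 / 2)"
    by (subst std_gaussian_integral_split[OF c, where K = K and L = 1 and g = "\<lambda>t. cos (norm q * t)"])
      (auto simp: inv' inner_add_right pc integral_std_normal_cos_sin intro!: bd)
  also have "(\<integral>x. sin (p \<bullet> x) * h x * sin (norm q * (c \<bullet> x)) \<partial>std_gaussian) = 0"
    by (subst std_gaussian_integral_split[OF c, where K = K and L = 1 and g = "\<lambda>t. sin (norm q * t)"])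
      (auto simp: inv' inner_add_right pc integral_std_normal_cos_sin intro!: bd)
  finally show ?thesis
    by (simp add: power2_norm_eq_inner mult.commute)
qed simp

lemma std_gaussian_integral_cos:
  "(\<integral>x. cos (b \<bullet> x) \<partial>std_gaussian) = exp (- (b \<bullet> b) / 2)"
  using std_gaussian_integral_cos_orthogonal[of 0 b "\<lambda>_. 1" 1]
  by (simp add: std_gaussian.prob_space[simplified])

section \<open>Mean and second moment of cosine sums\<close>

context
  fixes I :: "'i set" and c :: "'i \<Rightarrow> real" and a :: "'i \<Rightarrow> real ^ 'n" and G
  defines "G \<equiv> (\<lambda>x. \<Sum>\<beta>\<in>I. c \<beta> * cos (a \<beta> \<bullet> x))"
begin

lemma cosine_sum_bounded: "\<bar>G x\<bar> \<le> (\<Sum>\<beta>\<in>I. \<bar>c \<beta>\<bar>)"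
  unfolding G_def
  by (rule order_trans[OF sum_abs], rule sum_mono) (auto simp: abs_mult intro!: mult_left_le)

lemma integral_cosine_sum:
  "integral\<^sup>L std_gaussian G = (\<Sum>\<beta>\<in>I. c \<beta> * exp (- (a \<beta> \<bullet> a \<beta>) / 2))"
proof -
  have "integrable std_gaussian (\<lambda>x. cos (a \<beta> \<bullet> x))" for \<beta>
    by (rule integrable_std_gaussian_bounded[where K = 1]) auto
  then show ?thesis
    unfolding G_def by (simp add: std_gaussian_integral_cos)
qed

text \<open>Product-to-sum gives the frequencies \<open>b - d\<close> and \<open>b + d\<close>. The
  mixed terms of their squared norms contribute \<open>exp (b \<bullet> d)\<close> and
  \<open>exp (- (b \<bullet> d))\<close>, whose average is the \<open>cosh\<close>.\<close>

lemma integral_cosine_sum_sq: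
  "(\<integral>x. (G x)\<^sup>2 \<partial>std_gaussian) =
    (\<Sum>\<beta>\<in>I. \<Sum>\<gamma>\<in>I. (c \<beta> * exp (- (a \<beta> \<bullet> a \<beta>) / 2)) * (c \<gamma> * exp (- (a \<gamma> \<bullet> a \<gamma>) / 2)) * cosh (a \<beta> \<bullet> a \<gamma>))"
proof -
  have int: "integrable std_gaussian (\<lambda>x. cos (b \<bullet> x))" for b :: "real ^ 'n"
    by (rule integrable_std_gaussian_bounded[where K = 1]) auto
  have int2: "integrable std_gaussian (\<lambda>x. cos (b \<bullet> x) * cos (d \<bullet> x))" for b d :: "real ^ 'n"
    by (rule integrable_std_gaussian_bounded[where K = 1])
      (auto simp: abs_mult intro!: mult_le_one)
  have cc: "(\<integral>x. cos (b \<bullet> x) * cos (d \<bullet> x) \<partial>std_gaussian)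
      = exp (- (b \<bullet> b) / 2) * exp (- (d \<bullet> d) / 2) * cosh (b \<bullet> d)" for b d :: "real ^ 'n"
  proof -
    have "(\<integral>x. cos (b \<bullet> x) * cos (d \<bullet> x) \<partial>std_gaussian)
        = (\<integral>x. (cos ((b - d) \<bullet> x) + cos ((b + d) \<bullet> x)) / 2 \<partial>std_gaussian)"
      by (simp add: cos_times_cos inner_add_left inner_diff_left)
    also have "\<dots> = (exp (- ((b - d) \<bullet> (b - d)) / 2) + exp (- ((b + d) \<bullet> (b + d)) / 2)) / 2"
      using int by (simp add: std_gaussian_integral_cos)
    also have "- ((b - d) \<bullet> (b - d)) / 2 = - (b \<bullet> b) / 2 + - (d \<bullet> d) / 2 + b \<bullet> d"
      by (simp add: algebra_simps inner_commute[of d b] diff_divide_distrib add_divide_distrib)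
    also have "- ((b + d) \<bullet> (b + d)) / 2 = - (b \<bullet> b) / 2 + - (d \<bullet> d) / 2 + - (b \<bullet> d)"
      by (simp add: algebra_simps inner_commute[of d b] diff_divide_distrib add_divide_distrib)
    finally show ?thesis
      unfolding exp_add cosh_def by (simp add: algebra_simps add_divide_distrib)
  qed
  have "(\<integral>x. (G x)\<^sup>2 \<partial>std_gaussian) =
      (\<integral>x. (\<Sum>\<beta>\<in>I. \<Sum>\<gamma>\<in>I. c \<beta> * c \<gamma> * (cos (a \<beta> \<bullet> x) * cos (a \<gamma> \<bullet> x))) \<partial>std_gaussian)"
    by (simp add: G_def power2_eq_square sum_product ac_simps)
  also have "\<dots> = (\<Sum>\<beta>\<in>I. \<Sum>\<gamma>\<in>I. c \<beta> * c \<gamma> * (exp (- (a \<beta> \<bullet> a \<beta>) / 2) * exp (- (a \<gamma> \<bullet> a \<gamma>) / 2) * cosh (a \<beta> \<bullet> a \<gamma>)))"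
    using int2 by (simp add: cc)
  finally show ?thesis
    by (simp add: ac_simps)
qed

end

section \<open>Positive semidefinite kernels\<close>

definition psd_kernel :: "'i set \<Rightarrow> ('i \<Rightarrow> 'i \<Rightarrow> real) \<Rightarrow> bool" where
  "psd_kernel I K \<longleftrightarrow> (\<forall>u. 0 \<le> (\<Sum>\<beta>\<in>I. \<Sum>\<gamma>\<in>I. u \<beta> * u \<gamma> * K \<beta> \<gamma>))"

lemma psd_kernel_one: "psd_kernel I (\<lambda>_ _. 1)"
  by (simp add: psd_kernel_def flip: sum_product)

lemma psd_kernel_zero: "psd_kernel I (\<lambda>_ _. 0)"
  by (simp add: psd_kernel_def)

lemma psd_kernel_add:
  assumes "psd_kernel I K" "psd_kernel I L"
  shows "psd_kernel I (\<lambda>\<beta> \<gamma>. K \<beta> \<gamma> + L \<beta> \<gamma>)"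
  using assms by (simp add: psd_kernel_def distrib_left sum.distrib add_nonneg_nonneg)

lemma psd_kernel_sum:
  assumes "\<And>s. s \<in> S \<Longrightarrow> psd_kernel I (K s)"
  shows "psd_kernel I (\<lambda>\<beta> \<gamma>. \<Sum>s\<in>S. K s \<beta> \<gamma>)"
  using assms
  by (induction S rule: infinite_finite_induct) (auto simp: psd_kernel_zero psd_kernel_add)

lemma psd_kernel_rank_one:
  assumes "psd_kernel I K"
  shows "psd_kernel I (\<lambda>\<beta> \<gamma>. K \<beta> \<gamma> * (v \<beta> * v \<gamma>))"
proof (unfold psd_kernel_def, intro allI)
  fix u
  have "0 \<le> (\<Sum>\<beta>\<in>I. \<Sum>\<gamma>\<in>I. (u \<beta> * v \<beta>) * (u \<gamma> * v \<gamma>) * K \<beta> \<gamma>)"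
    using assms[unfolded psd_kernel_def, rule_format, of "\<lambda>\<beta>. u \<beta> * v \<beta>"] .
  then show "0 \<le> (\<Sum>\<beta>\<in>I. \<Sum>\<gamma>\<in>I. u \<beta> * u \<gamma> * (K \<beta> \<gamma> * (v \<beta> * v \<gamma>)))"
    by (simp add: ac_simps)
qed

text \<open>A case of the Schur product theorem: expanded in the standard basis, a Gram kernel is a
  sum of rank-one kernels, each of which is absorbed into the weights.\<close>

lemma psd_kernel_inner:
  fixes \<Phi> :: "'i \<Rightarrow> 'a::euclidean_space"
  assumes "psd_kernel I K"
  shows "psd_kernel I (\<lambda>\<beta> \<gamma>. K \<beta> \<gamma> * (\<Phi> \<beta> \<bullet> \<Phi> \<gamma>))"
  using psd_kernel_sum[of Basis I "\<lambda>e \<beta> \<gamma>. K \<beta> \<gamma> * ((\<Phi> \<beta> \<bullet> e) * (\<Phi> \<gamma> \<bullet> e))"]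
    psd_kernel_rank_one[OF assms]
  by (subst euclidean_inner) (simp add: sum_distrib_left)

text \<open>Write X and Y for the Gram kernels of \<open>\<Phi>\<close> and \<open>\<Psi>\<close>,
  and D(k) for the kernel in question. Then D(k+1) = D(k) X + D(k) Y + X^(k+1) Y, and multiplication
  by a Gram kernel preserves positivity.\<close>

lemma psd_kernel_power_diff:
  fixes \<Phi> \<Psi> :: "'i \<Rightarrow> 'a::euclidean_space"
  shows "psd_kernel I (\<lambda>\<beta> \<gamma>. (\<Phi> \<beta> \<bullet> \<Phi> \<gamma>) * ((\<Phi> \<beta> \<bullet> \<Phi> \<gamma> + \<Psi> \<beta> \<bullet> \<Psi> \<gamma>) ^ k - (\<Phi> \<beta> \<bullet> \<Phi> \<gamma>) ^ k))"
proof (induction k)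
  case 0
  then show ?case by (simp add: psd_kernel_zero)
next
  case (Suc k)
  have pow: "psd_kernel I (\<lambda>\<beta> \<gamma>. (\<Phi> \<beta> \<bullet> \<Phi> \<gamma>) ^ j)" for j
    by (induction j) (simp_all add: psd_kernel_one psd_kernel_inner mult.commute[of "_ \<bullet> _"])
  show ?case
    using psd_kernel_add[OF psd_kernel_add[OF psd_kernel_inner[OF Suc, of \<Phi>] psd_kernel_inner[OF Suc, of \<Psi>]]
        psd_kernel_inner[OF pow[of "Suc k"], of \<Psi>]]
    by (simp add: algebra_simps)
qed

section \<open>Orthogonal projections of symmetric families\<close>

definition orthonormal :: "(real ^ 'n) set \<Rightarrow> bool" where
  "orthonormal B \<longleftrightarrow> finite B \<and> pairwise orthogonal B \<and> (\<forall>v\<in>B. norm v = 1)"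

definition proj_onto :: "(real ^ 'n) set \<Rightarrow> real ^ 'n \<Rightarrow> real ^ 'n" where
  "proj_onto B x = (\<Sum>v\<in>B. (v \<bullet> x) *\<^sub>R v)"

lemma inner_proj_onto:
  assumes "orthonormal B" "v \<in> B"
  shows "v \<bullet> proj_onto B x = v \<bullet> x"
proof -
  have "v \<bullet> proj_onto B x = (\<Sum>w\<in>B. (w \<bullet> x) * (v \<bullet> w))"
    by (simp add: proj_onto_def inner_sum_right)
  also have "\<dots> = (\<Sum>w\<in>B. if w = v then v \<bullet> x else 0)"
    using assms by (intro sum.cong) (auto simp: orthonormal_def pairwise_def orthogonal_def norm_eq_1)
  finally show ?thesis using assms by (simp add: orthonormal_def)
qed

lemma inner_proj_onto_proj_onto:
  assumes "orthonormal B"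
  shows "proj_onto B x \<bullet> proj_onto B y = (\<Sum>v\<in>B. (v \<bullet> x) * (v \<bullet> y))"
  using assms by (subst proj_onto_def) (simp add: inner_sum_left inner_proj_onto)

lemma inner_diff_proj_onto:
  assumes "orthonormal B"
  shows "proj_onto B x \<bullet> (y - proj_onto B y) = 0" "(y - proj_onto B y) \<bullet> proj_onto B x = 0"
proof -
  show "proj_onto B x \<bullet> (y - proj_onto B y) = 0"
    using assms by (subst proj_onto_def) (simp add: inner_sum_left inner_diff_right inner_proj_onto)
  then show "(y - proj_onto B y) \<bullet> proj_onto B x = 0"
    by (simp add: inner_commute)
qed

lemma inner_proj_onto_split:
  assumes "orthonormal B"
  shows "x \<bullet> y = proj_onto B x \<bullet> proj_onto B y + (x - proj_onto B x) \<bullet> (y - proj_onto B y)"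
proof -
  have "x \<bullet> y = (proj_onto B x + (x - proj_onto B x)) \<bullet> (proj_onto B y + (y - proj_onto B y))"
    by simp
  then show ?thesis
    unfolding inner_add_left inner_add_right inner_diff_proj_onto[OF assms] by simp
qed

text \<open>Sign changes and transpositions generate the hyperoctahedral group, so invariance is
  demanded for these only. They act on indices rather than on vectors because distinct indices may
  carry the same frequency.\<close>

locale hyperoctahedral_family =
  fixes I :: "'i set" and b :: "'i \<Rightarrow> real ^ 'n" and u :: "'i \<Rightarrow> real"
  assumes finite_I: "finite I"
    and flip: "\<And>i. \<exists>f. bij_betw f I I \<and>
      (\<forall>\<beta>\<in>I. u (f \<beta>) = u \<beta> \<and> (\<forall>j. b (f \<beta>) $ j = (if j = i then - (b \<beta> $ j) else b \<beta> $ j)))"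
    and swap: "\<And>i j. \<exists>f. bij_betw f I I \<and>
      (\<forall>\<beta>\<in>I. u (f \<beta>) = u \<beta> \<and> (\<forall>k. b (f \<beta>) $ k = b \<beta> $ Transposition.transpose i j k))"
begin

text \<open>The coefficient of \<open>v $ i * v $ j\<close> when the weighted double sum of
  \<open>(v \<bullet> b \<beta>) * (v \<bullet> b \<gamma>) * (b \<beta> \<bullet> b \<gamma>) ^
  k\<close> is expanded in the coordinates of \<open>v\<close>.\<close>

definition moment :: "nat \<Rightarrow> 'n \<Rightarrow> 'n \<Rightarrow> real" where
  "moment k i j = (\<Sum>\<beta>\<in>I. \<Sum>\<gamma>\<in>I. u \<beta> * u \<gamma> * (b \<beta> $ i * b \<gamma> $ j * (b \<beta> \<bullet> b \<gamma>) ^ k))"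

lemma moment_transform:
  assumes f: "bij_betw f I I" and u: "\<And>\<beta>. \<beta> \<in> I \<Longrightarrow> u (f \<beta>) = u \<beta>"
    and inner: "\<And>\<beta> \<gamma>. \<beta> \<in> I \<Longrightarrow> \<gamma> \<in> I \<Longrightarrow> b (f \<beta>) \<bullet> b (f \<gamma>) = b \<beta> \<bullet> b \<gamma>"
  shows "moment k i j = (\<Sum>\<beta>\<in>I. \<Sum>\<gamma>\<in>I. u \<beta> * u \<gamma> * (b (f \<beta>) $ i * b (f \<gamma>) $ j * (b \<beta> \<bullet> b \<gamma>) ^ k))"
proof -
  have "moment k i j =
      (\<Sum>\<beta>\<in>I. \<Sum>\<gamma>\<in>I. u (f \<beta>) * u (f \<gamma>) * (b (f \<beta>) $ i * b (f \<gamma>) $ j * (b (f \<beta>) \<bullet> b (f \<gamma>)) ^ k))"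
    unfolding moment_def
    by (subst sum.reindex_bij_betw[OF f, symmetric]) (subst sum.reindex_bij_betw[OF f, symmetric], rule refl)
  also have "\<dots> = (\<Sum>\<beta>\<in>I. \<Sum>\<gamma>\<in>I. u \<beta> * u \<gamma> * (b (f \<beta>) $ i * b (f \<gamma>) $ j * (b \<beta> \<bullet> b \<gamma>) ^ k))"
    by (intro sum.cong refl) (simp add: u inner)
  finally show ?thesis .
qed

text \<open>Flipping the sign of coordinate \<open>i\<close> keeps weights and inner products but
  negates exactly one of the two coordinate factors, so the moment equals its own negative.\<close>

lemma moment_off_diagonal:
  assumes "i \<noteq> j"
  shows "moment k i j = 0"
proof -
  obtain f where f: "bij_betw f I I" "\<And>\<beta>. \<beta> \<in> I \<Longrightarrow> u (f \<beta>) = u \<beta>"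
    and bf: "\<And>\<beta> l. \<beta> \<in> I \<Longrightarrow> b (f \<beta>) $ l = (if l = i then - (b \<beta> $ l) else b \<beta> $ l)"
    using flip[of i] by blast
  have "b (f \<beta>) \<bullet> b (f \<gamma>) = b \<beta> \<bullet> b \<gamma>" if "\<beta> \<in> I" "\<gamma> \<in> I" for \<beta> \<gamma>
    using that by (auto simp: inner_vec_def bf intro!: sum.cong)
  from moment_transform[OF f this, of k i j]
  have "moment k i j = (\<Sum>\<beta>\<in>I. \<Sum>\<gamma>\<in>I. - (u \<beta> * u \<gamma> * (b \<beta> $ i * b \<gamma> $ j * (b \<beta> \<bullet> b \<gamma>) ^ k)))"
    using assms by (simp add: bf cong: sum.cong)
  then show ?thesis
    by (simp add: sum_negf moment_def)
qed

text \<open>Transpositions make all diagonal moments equal. Their sum over the coordinates assembles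
  one more factor \<open>b \<beta> \<bullet> b \<gamma>\<close>, hence the exponent
  \<open>Suc k\<close>.\<close>

lemma moment_diagonal:
  "moment k i i = (\<Sum>\<beta>\<in>I. \<Sum>\<gamma>\<in>I. u \<beta> * u \<gamma> * (b \<beta> \<bullet> b \<gamma>) ^ Suc k) / real CARD('n)"
proof -
  have eq: "moment k i i = moment k j j" for j
  proof -
    obtain f where f: "bij_betw f I I" "\<And>\<beta>. \<beta> \<in> I \<Longrightarrow> u (f \<beta>) = u \<beta>"
      and bf: "\<And>\<beta> l. \<beta> \<in> I \<Longrightarrow> b (f \<beta>) $ l = b \<beta> $ Transposition.transpose i j l"
      using swap[of i j] by blast
    have "b (f \<beta>) \<bullet> b (f \<gamma>) = b \<beta> \<bullet> b \<gamma>" if "\<beta> \<in> I" "\<gamma> \<in> I" for \<beta> \<gamma>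
      using sum.reindex_bij_betw[of "Transposition.transpose i j" UNIV UNIV "\<lambda>l. b \<beta> $ l * b \<gamma> $ l"] that
      by (simp add: inner_vec_def bf)
    from moment_transform[OF f this, of k i i] show ?thesis
      by (simp add: bf moment_def cong: sum.cong)
  qed
  have "real CARD('n) * moment k i i = (\<Sum>j\<in>UNIV. moment k j j)"
    by (subst sum.cong[OF refl eq[symmetric]]) simp
  also have "\<dots> = (\<Sum>\<beta>\<in>I. \<Sum>j\<in>UNIV. \<Sum>\<gamma>\<in>I. u \<beta> * u \<gamma> * (b \<beta> $ j * b \<gamma> $ j * (b \<beta> \<bullet> b \<gamma>) ^ k))"
    unfolding moment_def by (rule sum.swap)
  also have "\<dots> = (\<Sum>\<beta>\<in>I. \<Sum>\<gamma>\<in>I. \<Sum>j\<in>UNIV. u \<beta> * u \<gamma> * (b \<beta> $ j * b \<gamma> $ j * (b \<beta> \<bullet> b \<gamma>) ^ k))"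
    by (intro sum.cong refl sum.swap)
  also have "\<dots> = (\<Sum>\<beta>\<in>I. \<Sum>\<gamma>\<in>I. u \<beta> * u \<gamma> * (b \<beta> \<bullet> b \<gamma>) ^ Suc k)"
    by (simp add: inner_vec_def sum_distrib_left sum_distrib_right)
  finally show ?thesis by (simp add: field_simps)
qed

text \<open>Positivity trades all but one of the projected inner products for full ones. The
  surviving factor is a sum of rank-one forms over \<open>v \<in> B\<close>, and by the two moment
  lemmas each unit vector \<open>v\<close> contributes the share
  \<open>1 / CARD('n)\<close>.\<close>

lemma power_proj_onto_le:
  assumes B: "orthonormal B"
  shows "(\<Sum>\<beta>\<in>I. \<Sum>\<gamma>\<in>I. u \<beta> * u \<gamma> * (proj_onto B (b \<beta>) \<bullet> proj_onto B (b \<gamma>)) ^ Suc k)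
    \<le> real (card B) / real CARD('n) * (\<Sum>\<beta>\<in>I. \<Sum>\<gamma>\<in>I. u \<beta> * u \<gamma> * (b \<beta> \<bullet> b \<gamma>) ^ Suc k)"
proof -
  let ?X = "\<lambda>\<beta> \<gamma>. proj_onto B (b \<beta>) \<bullet> proj_onto B (b \<gamma>)"
  have "0 \<le> (\<Sum>\<beta>\<in>I. \<Sum>\<gamma>\<in>I. u \<beta> * u \<gamma> * (?X \<beta> \<gamma> * ((b \<beta> \<bullet> b \<gamma>) ^ k - ?X \<beta> \<gamma> ^ k)))"
    using psd_kernel_power_diff[of I "\<lambda>\<beta>. proj_onto B (b \<beta>)" "\<lambda>\<beta>. b \<beta> - proj_onto B (b \<beta>)" k]
    unfolding inner_proj_onto_split[OF B, symmetric] psd_kernel_def by blast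
  then have "(\<Sum>\<beta>\<in>I. \<Sum>\<gamma>\<in>I. u \<beta> * u \<gamma> * ?X \<beta> \<gamma> ^ Suc k)
      \<le> (\<Sum>\<beta>\<in>I. \<Sum>\<gamma>\<in>I. u \<beta> * u \<gamma> * (?X \<beta> \<gamma> * (b \<beta> \<bullet> b \<gamma>) ^ k))"
    by (simp add: right_diff_distrib sum_subtractf)
  also have "\<dots> = (\<Sum>\<beta>\<in>I. \<Sum>\<gamma>\<in>I. \<Sum>v\<in>B. \<Sum>i\<in>UNIV. \<Sum>j\<in>UNIV.
      v $ i * v $ j * (u \<beta> * u \<gamma> * (b \<beta> $ i * b \<gamma> $ j * (b \<beta> \<bullet> b \<gamma>) ^ k)))"
  proof (intro sum.cong refl)
    fix \<beta> \<gamma>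
    have "(v \<bullet> b \<beta>) * (v \<bullet> b \<gamma>) = (\<Sum>i\<in>UNIV. \<Sum>j\<in>UNIV. v $ i * v $ j * (b \<beta> $ i * b \<gamma> $ j))" for v
      by (simp add: inner_vec_def sum_product ac_simps)
    then show "u \<beta> * u \<gamma> * (?X \<beta> \<gamma> * (b \<beta> \<bullet> b \<gamma>) ^ k) = (\<Sum>v\<in>B. \<Sum>i\<in>UNIV. \<Sum>j\<in>UNIV.
      v $ i * v $ j * (u \<beta> * u \<gamma> * (b \<beta> $ i * b \<gamma> $ j * (b \<beta> \<bullet> b \<gamma>) ^ k)))"
      by (simp add: inner_proj_onto_proj_onto[OF B] sum_distrib_left sum_distrib_right mult_ac)
  qed
  also have "\<dots> = (\<Sum>v\<in>B. \<Sum>i\<in>UNIV. \<Sum>j\<in>UNIV. v $ i * v $ j * moment k i j)"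
  proof -
    have swap2: "(\<Sum>\<beta>\<in>I. \<Sum>\<gamma>\<in>I. \<Sum>s\<in>S. g \<beta> \<gamma> s) = (\<Sum>s\<in>S. \<Sum>\<beta>\<in>I. \<Sum>\<gamma>\<in>I. g \<beta> \<gamma> s)"
      for S :: "'s set" and g :: "'i \<Rightarrow> 'i \<Rightarrow> 's \<Rightarrow> real"
      by (subst sum.swap[of _ S I]) (intro sum.cong refl sum.swap)
    show ?thesis
      unfolding swap2 moment_def sum_distrib_left ..
  qed
  also have "\<dots> = (\<Sum>v\<in>B. \<Sum>i\<in>UNIV. v $ i * v $ i * moment k i i)"
  proof (intro sum.cong refl)
    fix v i
    have "(\<Sum>j\<in>UNIV. v $ i * v $ j * moment k i j) = (\<Sum>j\<in>UNIV. if j = i then v $ i * v $ i * moment k i i else 0)"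
      by (intro sum.cong refl) (auto simp: moment_off_diagonal)
    then show "(\<Sum>j\<in>UNIV. v $ i * v $ j * moment k i j) = v $ i * v $ i * moment k i i"
      by simp
  qed
  also have "\<dots> = (\<Sum>v\<in>B. (v \<bullet> v) * ((\<Sum>\<beta>\<in>I. \<Sum>\<gamma>\<in>I. u \<beta> * u \<gamma> * (b \<beta> \<bullet> b \<gamma>) ^ Suc k) / real CARD('n)))"
    by (simp add: moment_diagonal inner_vec_def sum_distrib_right sum_divide_distrib)
  also have "\<dots> = real (card B) / real CARD('n) * (\<Sum>\<beta>\<in>I. \<Sum>\<gamma>\<in>I. u \<beta> * u \<gamma> * (b \<beta> \<bullet> b \<gamma>) ^ Suc k)"
    using B by (simp add: orthonormal_def norm_eq_1)
  finally show ?thesis .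
qed

lemma cosh_proj_onto_le:
  assumes B: "orthonormal B"
  shows "(\<Sum>\<beta>\<in>I. \<Sum>\<gamma>\<in>I. u \<beta> * u \<gamma> * (cosh (proj_onto B (b \<beta>) \<bullet> proj_onto B (b \<gamma>)) - 1))
    \<le> real (card B) / real CARD('n) * (\<Sum>\<beta>\<in>I. \<Sum>\<gamma>\<in>I. u \<beta> * u \<gamma> * (cosh (b \<beta> \<bullet> b \<gamma>) - 1))"
proof -
  \<comment> \<open>The Taylor coefficient of \<open>cosh\<close> in degree \<open>Suc k\<close>.
    The shift removes the constant term, which accounts for the \<open>- 1\<close>, and leaves only
    the positive exponents covered by the bound on powers; nonnegativity allows summing that
    bound.\<close>
  define t where "t k = (if even (Suc k) then 1 / fact (Suc k) else 0 :: real)" for k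
  have t: "0 \<le> t k" for k by (simp add: t_def)
  have cosh: "(\<lambda>k. t k * x ^ Suc k) sums (cosh x - 1)" for x :: real
  proof -
    have "(\<lambda>k. (\<lambda>n. if even n then x ^ n /\<^sub>R fact n else 0) (Suc k)) sums (cosh x - 1)"
      using cosh_converges[of x] by (subst sums_Suc_iff) simp
    then show ?thesis
      by (rule sums_cong[THEN iffD1, rotated]) (simp add: t_def divide_inverse)
  qed
  have sums: "(\<lambda>k. t k * (\<Sum>\<beta>\<in>I. \<Sum>\<gamma>\<in>I. u \<beta> * u \<gamma> * X \<beta> \<gamma> ^ Suc k))
      sums (\<Sum>\<beta>\<in>I. \<Sum>\<gamma>\<in>I. u \<beta> * u \<gamma> * (cosh (X \<beta> \<gamma>) - 1))" for X
  proof -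
    have "(\<lambda>k. \<Sum>\<beta>\<in>I. \<Sum>\<gamma>\<in>I. u \<beta> * u \<gamma> * (t k * X \<beta> \<gamma> ^ Suc k))
        sums (\<Sum>\<beta>\<in>I. \<Sum>\<gamma>\<in>I. u \<beta> * u \<gamma> * (cosh (X \<beta> \<gamma>) - 1))"
      by (intro sums_sum sums_mult cosh)
    then show ?thesis
      unfolding sum_distrib_left by (simp only: mult.left_commute)
  qed
  show ?thesis
  proof (rule sums_le[OF _ sums sums_mult[OF sums]])
    fix k
    show "t k * (\<Sum>\<beta>\<in>I. \<Sum>\<gamma>\<in>I. u \<beta> * u \<gamma> * (proj_onto B (b \<beta>) \<bullet> proj_onto B (b \<gamma>)) ^ Suc k)
      \<le> real (card B) / real CARD('n) * (t k * (\<Sum>\<beta>\<in>I. \<Sum>\<gamma>\<in>I. u \<beta> * u \<gamma> * (b \<beta> \<bullet> b \<gamma>) ^ Suc k))"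
      by (subst mult.left_commute) (rule mult_left_mono[OF power_proj_onto_le[OF B] t])
  qed
qed

end

section \<open>Covariance with functions of few directions\<close>

lemma (in hyperoctahedral_family) gaussian_weights:
  "hyperoctahedral_family I b (\<lambda>\<beta>. u \<beta> * exp (- (b \<beta> \<bullet> b \<beta>) / 2))"
proof
  show "finite I" by (rule finite_I)
next
  fix i
  obtain f where f: "bij_betw f I I" "\<forall>\<beta>\<in>I. u (f \<beta>) = u \<beta> \<and>
      (\<forall>j. b (f \<beta>) $ j = (if j = i then - (b \<beta> $ j) else b \<beta> $ j))"
    using flip[of i] by blast
  \<comment> \<open>The Gaussian factor depends on the norm of the frequency only, which a sign
    change preserves; likewise below for transpositions.\<close>
  have "b (f \<beta>) \<bullet> b (f \<beta>) = b \<beta> \<bullet> b \<beta>" if "\<beta> \<in> I" for \<beta>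
    unfolding inner_vec_def using f(2) that by (intro sum.cong) auto
  with f show "\<exists>f. bij_betw f I I \<and> (\<forall>\<beta>\<in>I. u (f \<beta>) * exp (- (b (f \<beta>) \<bullet> b (f \<beta>)) / 2) = u \<beta> * exp (- (b \<beta> \<bullet> b \<beta>) / 2) \<and>
      (\<forall>j. b (f \<beta>) $ j = (if j = i then - (b \<beta> $ j) else b \<beta> $ j)))"
    by (intro exI[of _ f]) simp
next
  fix i j
  obtain f where f: "bij_betw f I I" "\<forall>\<beta>\<in>I. u (f \<beta>) = u \<beta> \<and>
      (\<forall>k. b (f \<beta>) $ k = b \<beta> $ Transposition.transpose i j k)"
    using swap[of i j] by blast
  have "b (f \<beta>) \<bullet> b (f \<beta>) = b \<beta> \<bullet> b \<beta>" if "\<beta> \<in> I" for \<beta>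
    using sum.reindex_bij_betw[of "Transposition.transpose i j" UNIV UNIV "\<lambda>l. b \<beta> $ l * b \<beta> $ l"] f(2) that
    by (simp add: inner_vec_def)
  with f show "\<exists>f. bij_betw f I I \<and> (\<forall>\<beta>\<in>I. u (f \<beta>) * exp (- (b (f \<beta>) \<bullet> b (f \<beta>)) / 2) = u \<beta> * exp (- (b \<beta> \<bullet> b \<beta>) / 2) \<and>
      (\<forall>k. b (f \<beta>) $ k = b \<beta> $ Transposition.transpose i j k))"
    by (intro exI[of _ f]) simp
qed

text \<open>\<open>F'\<close> below is the conditional expectation of \<open>F\<close> given the
  span of \<open>B\<close>, written as a cosine sum over projected frequencies, and has the same
  covariance with \<open>h\<close>. As \<open>h\<close> stays within 1/2 of 1/2, Cauchy-Schwarz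
  bounds the squared covariance by a quarter of the variance of \<open>F'\<close>, to which the
  \<open>cosh\<close> comparison applies.\<close>

lemma (in hyperoctahedral_family) covariance_cosine_sum_le:
  fixes h :: "real ^ 'n \<Rightarrow> real"
  defines "F \<equiv> (\<lambda>x. \<Sum>\<beta>\<in>I. u \<beta> * cos (b \<beta> \<bullet> x))"
  assumes B: "orthonormal B"
    and [measurable]: "h \<in> borel_measurable borel" and h: "\<And>x. 0 \<le> h x" "\<And>x. h x \<le> 1"
    and inv: "\<And>x q. (\<And>v. v \<in> B \<Longrightarrow> v \<bullet> q = 0) \<Longrightarrow> h (x + q) = h x"
  shows "((\<integral>x. F x * h x \<partial>std_gaussian) - integral\<^sup>L std_gaussian F * integral\<^sup>L std_gaussian h)\<^sup>2
    \<le> real (card B) / real CARD('n) / 4 * ((\<integral>x. (F x)\<^sup>2 \<partial>std_gaussian) - (integral\<^sup>L std_gaussian F)\<^sup>2)"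
proof -
  define P where "P = proj_onto B"
  define Q where "Q x = x - P x" for x
  define w where "w \<beta> = u \<beta> * exp (- (b \<beta> \<bullet> b \<beta>) / 2)" for \<beta>
  define c where "c \<beta> = u \<beta> * exp (- (Q (b \<beta>) \<bullet> Q (b \<beta>)) / 2)" for \<beta>
  define F' where "F' = (\<lambda>x. \<Sum>\<beta>\<in>I. c \<beta> * cos (P (b \<beta>) \<bullet> x))"
  interpret w: hyperoctahedral_family I b w
    using gaussian_weights by (simp add: w_def[abs_def])
  have PQ: "P x \<bullet> Q y = 0" for x y
    using inner_diff_proj_onto[OF B] by (simp add: P_def Q_def)
  \<comment> \<open>Thus \<open>F\<close> and \<open>F'\<close> have the same Gaussian weights
    \<open>w\<close>, and their variances differ only in the argument of
    \<open>cosh\<close>.\<close>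
  have cw: "c \<beta> * exp (- (P (b \<beta>) \<bullet> P (b \<beta>)) / 2) = w \<beta>" for \<beta>
  proof -
    have "- (b \<beta> \<bullet> b \<beta>) / 2 = - (Q (b \<beta>) \<bullet> Q (b \<beta>)) / 2 + - (P (b \<beta>) \<bullet> P (b \<beta>)) / 2"
      using inner_proj_onto_split[OF B, of "b \<beta>" "b \<beta>"] by (simp add: P_def Q_def)
    then show ?thesis
      unfolding c_def w_def by (simp only: exp_add mult.assoc)
  qed
  have F [measurable]: "F \<in> borel_measurable borel" and F' [measurable]: "F' \<in> borel_measurable borel"
    unfolding F_def F'_def by measurable
  have abs_h: "\<bar>h x\<bar> \<le> 1" for x using h[of x] by simp
  have int_h: "integrable std_gaussian h"
    using abs_h by (intro integrable_std_gaussian_bounded) auto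
  have int_cos_h: "integrable std_gaussian (\<lambda>x. cos (a \<bullet> x) * h x)" for a
    using abs_h by (intro integrable_std_gaussian_bounded[where K = 1]) (auto simp: abs_mult intro!: mult_le_one)
  define K where "K = (\<Sum>\<beta>\<in>I. \<bar>c \<beta>\<bar>)"
  have F'_le: "\<bar>F' x\<bar> \<le> K" for x
    unfolding F'_def K_def by (rule cosine_sum_bounded)
  have K: "0 \<le> K" by (simp add: K_def sum_nonneg)
  have int_F': "integrable std_gaussian F'"
    using F'_le by (intro integrable_std_gaussian_bounded) auto
  define \<mu> where "\<mu> = integral\<^sup>L std_gaussian F"
  have mu: "\<mu> = sum w I"
    unfolding \<mu>_def F_def integral_cosine_sum w_def ..
  have mu': "integral\<^sup>L std_gaussian F' = \<mu>"
    unfolding F'_def integral_cosine_sum cw mu ..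
  have var: "(\<integral>x. (F x)\<^sup>2 \<partial>std_gaussian) - \<mu>\<^sup>2 = (\<Sum>\<beta>\<in>I. \<Sum>\<gamma>\<in>I. w \<beta> * w \<gamma> * (cosh (b \<beta> \<bullet> b \<gamma>) - 1))"
    unfolding F_def integral_cosine_sum_sq w_def[symmetric] mu
    by (simp add: right_diff_distrib sum_subtractf power2_eq_square sum_product)
  have var': "(\<integral>x. (F' x)\<^sup>2 \<partial>std_gaussian) - \<mu>\<^sup>2 = (\<Sum>\<beta>\<in>I. \<Sum>\<gamma>\<in>I. w \<beta> * w \<gamma> * (cosh (P (b \<beta>) \<bullet> P (b \<gamma>)) - 1))"
    unfolding F'_def integral_cosine_sum_sq cw mu
    by (simp add: right_diff_distrib sum_subtractf power2_eq_square sum_product)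
  have proj: "(\<integral>x. cos (b \<beta> \<bullet> x) * h x \<partial>std_gaussian)
      = exp (- (Q (b \<beta>) \<bullet> Q (b \<beta>)) / 2) * (\<integral>x. cos (P (b \<beta>) \<bullet> x) * h x \<partial>std_gaussian)" for \<beta>
  proof -
    have "h (x + s *\<^sub>R Q (b \<beta>)) = h x" for x s
      by (rule inv) (simp add: Q_def P_def inner_diff_right inner_proj_onto[OF B])
    from std_gaussian_integral_cos_orthogonal[OF PQ[of "b \<beta>" "b \<beta>"] _ abs_h this] show ?thesis
      by (simp add: Q_def)
  qed
  have "(\<integral>x. F x * h x \<partial>std_gaussian) = (\<Sum>\<beta>\<in>I. u \<beta> * (\<integral>x. cos (b \<beta> \<bullet> x) * h x \<partial>std_gaussian))"
    unfolding F_def using int_cos_h by (simp add: sum_distrib_right mult.assoc)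
  also have "\<dots> = (\<Sum>\<beta>\<in>I. c \<beta> * (\<integral>x. cos (P (b \<beta>) \<bullet> x) * h x \<partial>std_gaussian))"
    by (simp add: proj c_def mult.assoc)
  also have "\<dots> = (\<integral>x. F' x * h x \<partial>std_gaussian)"
    unfolding F'_def using int_cos_h by (simp add: sum_distrib_right mult.assoc)
  finally have FF': "(\<integral>x. F x * h x \<partial>std_gaussian) = (\<integral>x. F' x * h x \<partial>std_gaussian)" .
  define Z where "Z x = \<bar>F' x - \<mu>\<bar>" for x
  have [measurable]: "Z \<in> borel_measurable borel" unfolding Z_def by measurable
  have Z_le: "\<bar>Z x\<bar> \<le> K + \<bar>\<mu>\<bar>" for x
    using F'_le[of x] by (simp add: Z_def)
  have int_Z: "integrable std_gaussian Z"
    using Z_le by (intro integrable_std_gaussian_bounded) auto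
  have int_Z2: "integrable std_gaussian (\<lambda>x. (Z x)\<^sup>2)"
  proof (rule integrable_std_gaussian_bounded)
    show "\<bar>(Z x)\<^sup>2\<bar> \<le> (K + \<bar>\<mu>\<bar>)\<^sup>2" for x
      using power_mono[OF Z_le, of x 2] by simp
  qed auto
  have int_F'h: "integrable std_gaussian (\<lambda>x. F' x * h x)"
    using mult_mono[OF F'_le abs_h] K by (intro integrable_std_gaussian_bounded[where K = K]) (auto simp: abs_mult)
  have int_F'2: "integrable std_gaussian (\<lambda>x. (F' x)\<^sup>2)"
    using power_mono[OF F'_le, of _ 2] by (intro integrable_std_gaussian_bounded[where K = "K\<^sup>2"]) auto
  have one: "measure std_gaussian (UNIV :: (real ^ 'n) set) = 1"
    using std_gaussian.prob_space by simp
  \<comment> \<open>\<open>F' - \<mu>\<close> has mean zero, so centring \<open>h\<close> at 1/2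
    leaves the covariance unchanged.\<close>
  have "(\<integral>x. F x * h x \<partial>std_gaussian) - \<mu> * integral\<^sup>L std_gaussian h
      = (\<integral>x. (F' x - \<mu>) * (h x - 1 / 2) \<partial>std_gaussian)"
    using int_F'h int_F' int_h by (simp add: FF' algebra_simps mu' one)
  also have "\<bar>\<dots>\<bar> \<le> (\<integral>x. Z x / 2 \<partial>std_gaussian)"
  proof (rule order_trans[OF integral_abs_bound integral_mono])
    have le: "\<bar>(F' x - \<mu>) * (h x - 1 / 2)\<bar> \<le> Z x / 2" for x
    proof -
      have "\<bar>h x - 1 / 2\<bar> \<le> 1 / 2" using h[of x] unfolding abs_le_iff by simp
      from mult_left_mono[OF this, of "Z x"] show ?thesis
        by (simp add: Z_def abs_mult)
    qed
    have le': "\<bar>(F' x - \<mu>) * (h x - 1 / 2)\<bar> \<le> (K + \<bar>\<mu>\<bar>) / 2" for x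
      using le[of x] Z_le[of x] by simp
    show "integrable std_gaussian (\<lambda>x. \<bar>(F' x - \<mu>) * (h x - 1 / 2)\<bar>)"
      using le' by (intro integrable_std_gaussian_bounded[where K = "(K + \<bar>\<mu>\<bar>) / 2"]) auto
    show "\<bar>(F' x - \<mu>) * (h x - 1 / 2)\<bar> \<le> Z x / 2" for x by (rule le)
  qed (use int_Z in simp)
  finally have "\<bar>(\<integral>x. F x * h x \<partial>std_gaussian) - \<mu> * integral\<^sup>L std_gaussian h\<bar>
      \<le> integral\<^sup>L std_gaussian Z / 2"
    by simp
  from power_mono[OF this, of 2]
  have "((\<integral>x. F x * h x \<partial>std_gaussian) - \<mu> * integral\<^sup>L std_gaussian h)\<^sup>2 \<le> (integral\<^sup>L std_gaussian Z)\<^sup>2 / 4"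
    by (simp add: power_divide)
  \<comment> \<open>Nonnegativity of the variance of \<open>Z\<close>.\<close>
  also have "(integral\<^sup>L std_gaussian Z)\<^sup>2 \<le> (\<integral>x. (Z x)\<^sup>2 \<partial>std_gaussian)"
    using std_gaussian.variance_positive[of Z] std_gaussian.variance_eq[OF int_Z int_Z2] by simp
  also have "(\<integral>x. (Z x)\<^sup>2 \<partial>std_gaussian) = (\<integral>x. (F' x)\<^sup>2 \<partial>std_gaussian) - \<mu>\<^sup>2"
    using std_gaussian.variance_eq[OF int_F' int_F'2] by (simp add: Z_def mu')
  also have "\<dots> \<le> real (card B) / real CARD('n) * ((\<integral>x. (F x)\<^sup>2 \<partial>std_gaussian) - \<mu>\<^sup>2)"
    unfolding var var' P_def by (rule w.cosh_proj_onto_le[OF B])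
  finally show ?thesis
    by (simp add: \<mu>_def)
qed

section \<open>Trigonometric approximation of the cube\<close>

text \<open>Frequencies are arbitrary reals, so that the period can grow with the approximation;
  having cosines only makes these functions even, which is the source of the sign invariance of
  their products.\<close>

definition cosine_poly :: "(real \<Rightarrow> real) \<Rightarrow> bool" where
  "cosine_poly p \<longleftrightarrow> (\<exists>(N::nat) \<alpha> \<kappa>. \<forall>s. p s = (\<Sum>k<N. \<alpha> k * cos (\<kappa> k * s)))"

text \<open>Each cosine is half the sum of two complex exponentials, and a product of exponentials
  over the coordinates is one exponential of an inner product. An index chooses a term of
  \<open>p\<close> and a sign at every coordinate; the same \<open>p\<close> is used at each of
  them, so reversing a sign or permuting the choices preserves the weight.\<close>

lemma prod_cosine_poly:
  assumes "cosine_poly p"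
  obtains I :: "('n::finite \<Rightarrow> nat \<times> real) set" and b :: "_ \<Rightarrow> real ^ 'n" and w
  where "hyperoctahedral_family I b w"
    "\<And>x :: real ^ 'n. (\<Prod>i\<in>UNIV. p (x $ i)) = (\<Sum>\<beta>\<in>I. w \<beta> * cos (b \<beta> \<bullet> x))"
proof -
  from assms obtain N :: nat and \<alpha> \<kappa> where p: "\<And>s. p s = (\<Sum>k<N. \<alpha> k * cos (\<kappa> k * s))"
    unfolding cosine_poly_def by blast
  define J where "J = {..<N} \<times> {1, -1 :: real}"
  define I where "I = {\<beta> :: 'n \<Rightarrow> nat \<times> real. \<forall>i. \<beta> i \<in> J}"
  define b :: "('n \<Rightarrow> nat \<times> real) \<Rightarrow> real ^ 'n" where
    "b \<beta> = (\<chi> i. snd (\<beta> i) * \<kappa> (fst (\<beta> i)))" for \<beta>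
  define w where "w \<beta> = (\<Prod>i\<in>UNIV. \<alpha> (fst (\<beta> i)) / 2)" for \<beta> :: "'n \<Rightarrow> nat \<times> real"
  have I: "I = PiE UNIV (\<lambda>_. J)"
    by (auto simp: I_def PiE_def)
  have "finite J" by (simp add: J_def)
  have neg: "(k, - e) \<in> J" if "(k, e) \<in> J" for k e
    using that by (auto simp: J_def)
  have "hyperoctahedral_family I b w"
  proof (rule hyperoctahedral_family.intro)
    show "finite I" unfolding I using \<open>finite J\<close> by (simp add: finite_PiE)
  next
    fix i
    define f where "f \<beta> = \<beta>(i := (fst (\<beta> i), - snd (\<beta> i)))" for \<beta> :: "'n \<Rightarrow> nat \<times> real"
    have fI: "f \<beta> \<in> I" if "\<beta> \<in> I" for \<beta>
      using that neg[of "fst (\<beta> i)" "snd (\<beta> i)"] by (auto simp: f_def I_def)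
    have "f (f \<beta>) = \<beta>" for \<beta> by (simp add: f_def)
    then have "bij_betw f I I"
      using fI by (intro bij_betw_byWitness[where f' = f]) auto
    moreover have "w (f \<beta>) = w \<beta>" for \<beta>
      unfolding w_def f_def by (intro prod.cong) auto
    moreover have "b (f \<beta>) $ j = (if j = i then - (b \<beta> $ j) else b \<beta> $ j)" for \<beta> j
      by (simp add: b_def f_def)
    ultimately show "\<exists>f. bij_betw f I I \<and> (\<forall>\<beta>\<in>I. w (f \<beta>) = w \<beta> \<and>
        (\<forall>j. b (f \<beta>) $ j = (if j = i then - (b \<beta> $ j) else b \<beta> $ j)))"
      by blast
  next
    fix i j
    let ?t = "Transposition.transpose i j :: 'n \<Rightarrow> 'n"
    define f where "f \<beta> = \<beta> \<circ> ?t" for \<beta> :: "'n \<Rightarrow> nat \<times> real"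
    have fI: "f \<beta> \<in> I" if "\<beta> \<in> I" for \<beta>
      using that by (simp add: f_def I_def)
    have "f (f \<beta>) = \<beta>" for \<beta> by (simp add: f_def fun_eq_iff)
    then have "bij_betw f I I"
      using fI by (intro bij_betw_byWitness[where f' = f]) auto
    moreover have "w (f \<beta>) = w \<beta>" for \<beta>
      using prod.reindex_bij_betw[of ?t UNIV UNIV "\<lambda>i. \<alpha> (fst (\<beta> i)) / 2"]
      by (simp add: w_def f_def)
    moreover have "b (f \<beta>) $ k = b \<beta> $ ?t k" for \<beta> k
      by (simp add: b_def f_def)
    ultimately show "\<exists>f. bij_betw f I I \<and> (\<forall>\<beta>\<in>I. w (f \<beta>) = w \<beta> \<and> (\<forall>k. b (f \<beta>) $ k = b \<beta> $ ?t k))"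
      by blast
  qed
  moreover have "(\<Prod>i\<in>UNIV. p (x $ i)) = (\<Sum>\<beta>\<in>I. w \<beta> * cos (b \<beta> \<bullet> x))" for x :: "real ^ 'n"
  proof -
    have p': "complex_of_real (p s) = (\<Sum>(k, e)\<in>J. of_real (\<alpha> k / 2) * cis (e * \<kappa> k * s))" for s
    proof -
      have "cis (1 * \<kappa> k * s) + cis (- 1 * \<kappa> k * s) = of_real (2 * cos (\<kappa> k * s))" for k
        by (simp add: complex_eq_iff)
      then have "of_real (\<alpha> k / 2) * cis (1 * \<kappa> k * s) + of_real (\<alpha> k / 2) * cis (- 1 * \<kappa> k * s)
          = complex_of_real (\<alpha> k * cos (\<kappa> k * s))" for k
        unfolding distrib_left[symmetric] by simp
      then show ?thesis
        by (simp add: J_def p sum.cartesian_product[symmetric])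
    qed
    have "complex_of_real (\<Prod>i\<in>UNIV. p (x $ i))
        = (\<Prod>i\<in>UNIV. \<Sum>y\<in>J. of_real (\<alpha> (fst y) / 2) * cis (snd y * \<kappa> (fst y) * x $ i))"
      by (simp add: p' case_prod_unfold)
    also have "\<dots> = (\<Sum>\<beta>\<in>I. \<Prod>i\<in>UNIV. of_real (\<alpha> (fst (\<beta> i)) / 2) * cis (snd (\<beta> i) * \<kappa> (fst (\<beta> i)) * x $ i))"
      unfolding I using \<open>finite J\<close> by (subst prod_sum_PiE) auto
    also have "\<dots> = (\<Sum>\<beta>\<in>I. of_real (w \<beta>) * cis (b \<beta> \<bullet> x))"
      unfolding prod.distrib
      by (simp add: w_def b_def inner_vec_def cis_conv_exp exp_sum sum_distrib_left)
    \<comment> \<open>The product is real, so taking real parts leaves just the cosines.\<close>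
    finally have "(\<Prod>i\<in>UNIV. p (x $ i)) = Re (\<Sum>\<beta>\<in>I. of_real (w \<beta>) * cis (b \<beta> \<bullet> x))"
      by (metis Re_complex_of_real)
    then show ?thesis by simp
  qed
  ultimately show thesis using that by blast
qed

text \<open>With lists, adding two representations is concatenation and needs no reindexing.\<close>

lemma cosine_poly_list:
  "cosine_poly p \<longleftrightarrow> (\<exists>xs. \<forall>s. p s = (\<Sum>(a, k)\<leftarrow>xs. a * cos (k * s)))"
proof
  assume "cosine_poly p"
  then obtain N :: nat and \<alpha> \<kappa> where p: "\<And>s. p s = (\<Sum>k<N. \<alpha> k * cos (\<kappa> k * s))"
    unfolding cosine_poly_def by blast
  show "\<exists>xs. \<forall>s. p s = (\<Sum>(a, k)\<leftarrow>xs. a * cos (k * s))"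
    by (rule exI[of _ "map (\<lambda>k. (\<alpha> k, \<kappa> k)) [0..<N]"])
      (simp add: p o_def interv_sum_list_conv_sum_set_nat atLeast0LessThan)
next
  assume "\<exists>xs. \<forall>s. p s = (\<Sum>(a, k)\<leftarrow>xs. a * cos (k * s))"
  then obtain xs where p: "\<And>s. p s = (\<Sum>(a, k)\<leftarrow>xs. a * cos (k * s))" by blast
  show "cosine_poly p"
    unfolding cosine_poly_def
    by (rule exI[of _ "length xs"], rule exI[of _ "\<lambda>i. fst (xs ! i)"], rule exI[of _ "\<lambda>i. snd (xs ! i)"])
      (simp add: p sum_list_sum_nth atLeast0LessThan case_prod_unfold)
qed

section \<open>Algebra of even trigonometric sums\<close>

lemma cosine_poly_const: "cosine_poly (\<lambda>_. a)"
  unfolding cosine_poly_list by (rule exI[of _ "[(a, 0)]"]) simp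

lemma cosine_poly_add:
  assumes "cosine_poly p" "cosine_poly q"
  shows "cosine_poly (\<lambda>s. p s + q s)"
proof -
  obtain xs ys where "\<And>s. p s = (\<Sum>(a, k)\<leftarrow>xs. a * cos (k * s))" "\<And>s. q s = (\<Sum>(a, k)\<leftarrow>ys. a * cos (k * s))"
    using assms unfolding cosine_poly_list by blast
  then show ?thesis
    unfolding cosine_poly_list by (intro exI[of _ "xs @ ys"]) simp
qed

lemma cosine_poly_mult_cos:
  assumes "cosine_poly p"
  shows "cosine_poly (\<lambda>s. c * cos (u * s) * p s)"
proof -
  obtain xs where p: "\<And>s. p s = (\<Sum>(a, k)\<leftarrow>xs. a * cos (k * s))"
    using assms unfolding cosine_poly_list by blast
  \<comment> \<open>By product-to-sum each term splits in two, with half the amplitude.\<close>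
  have "c * cos (u * s) * (\<Sum>(a, k)\<leftarrow>xs. a * cos (k * s))
      = (\<Sum>(a, k)\<leftarrow>map (\<lambda>(a, k). (c * a / 2, u - k)) xs @ map (\<lambda>(a, k). (c * a / 2, u + k)) xs. a * cos (k * s))" for s
  proof (induction xs)
    case (Cons y xs)
    have "c * cos (u * s) * (snd y * 0 + fst y * cos (snd y * s))
        = c * fst y / 2 * cos ((u - snd y) * s) + c * fst y / 2 * cos ((u + snd y) * s)"
      by (simp add: left_diff_distrib distrib_right cos_add cos_diff algebra_simps)
    with Cons show ?case
      by (simp add: case_prod_unfold distrib_left)
  qed simp
  then show ?thesis
    unfolding cosine_poly_list p by blast
qed

lemma cosine_poly_polynomial:
  "cosine_poly (\<lambda>s. \<Sum>i\<le>(m::nat). a i * cos (u * s) ^ i)"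
proof -
  have pow: "cosine_poly (\<lambda>s. cos (u * s) ^ i)" for i
    using cosine_poly_mult_cos[of _ 1 u] by (induction i) (simp_all add: cosine_poly_const)
  \<comment> \<open>Frequency 0 reduces the cosine factor to the scalar \<open>c\<close>.\<close>
  have scale: "cosine_poly (\<lambda>s. c * cos (u * s) ^ i)" for c i
    using cosine_poly_mult_cos[OF pow[of i], of c 0] by simp
  show ?thesis
  proof (induction m)
    case 0
    show ?case using scale[of "a 0" 0] by simp
  next
    case (Suc m)
    show ?case using cosine_poly_add[OF Suc scale[of "a (Suc m)" "Suc m"]] by simp
  qed
qed

text \<open>A continuous even ramp on \<open>{-L..L}\<close> is a continuous function of
  \<open>cos (pi * s / L)\<close>, so Weierstrass approximation on \<open>{-1..1}\<close> yields a
  polynomial in that cosine. The half period \<open>L\<close> grows while the ramp steepens, which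
  gives pointwise convergence.\<close>

lemma cosine_poly_approx_interval:
  fixes r :: real
  assumes r: "r > 0"
  obtains p where "\<And>n::nat. cosine_poly (p n)" "\<And>n s. \<bar>p n s\<bar> \<le> 2"
    "\<And>s. (\<lambda>n. p n s) \<longlonglongrightarrow> indicator {-r..r} s"
proof -
  \<comment> \<open>The ramp is 1 up to and including \<open>r\<close>, so the limit is the
    indicator of the closed interval, and it falls linearly to 0 at
    \<open>r + 1 / real (Suc n)\<close>.\<close>
  define g where "g n s = max 0 (min 1 (1 + real (Suc n) * (r - s)))" for n s
  define L where "L n = r + real (Suc n)" for n
  have L: "L n > 0" for n using r by (simp add: L_def)
  have "\<exists>p. cosine_poly p \<and> (\<forall>s. \<bar>p s\<bar> \<le> 2) \<and> (\<forall>s. \<bar>s\<bar> \<le> L n \<longrightarrow> \<bar>g n (abs s) - p s\<bar> < 1 / real (Suc n))" for n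
  proof -
    define u where "u = pi / L n"
    have u: "u > 0" using L[of n] by (simp add: u_def)
    have cont: "continuous_on {-1..1} (\<lambda>c. g n (arccos c / u))"
      unfolding g_def using u by (intro continuous_intros) auto
    obtain q where q: "real_polynomial_function q"
      and approx: "\<And>c. c \<in> {-1..1} \<Longrightarrow> \<bar>g n (arccos c / u) - q c\<bar> < 1 / real (Suc n)"
      using Stone_Weierstrass_real_polynomial_function[OF compact_Icc cont, of "1 / real (Suc n)"] by auto
    obtain a m where qa: "q = (\<lambda>x. \<Sum>i\<le>(m::nat). a i * x ^ i)"
      using real_polynomial_function_imp_sum[OF q] by blast
    define p where "p s = q (cos (u * s))" for s
    have "cosine_poly p"
      unfolding p_def[abs_def] qa by (rule cosine_poly_polynomial)
    \<comment> \<open>Valid on the whole line, since \<open>cos (u * s)\<close> always lies in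
      \<open>{-1..1}\<close>: the ramp contributes at most 1 and so does the error.\<close>
    moreover have "\<bar>p s\<bar> \<le> 2" for s
    proof -
      have "\<bar>g n (arccos (cos (u * s)) / u)\<bar> \<le> 1" "1 / real (Suc n) \<le> 1"
        by (simp_all add: g_def)
      moreover have "\<bar>g n (arccos (cos (u * s)) / u) - p s\<bar> < 1 / real (Suc n)"
        unfolding p_def by (rule approx) auto
      ultimately show ?thesis by linarith
    qed
    moreover have "\<bar>g n (abs s) - p s\<bar> < 1 / real (Suc n)" if "\<bar>s\<bar> \<le> L n" for s
    proof -
      have "u * \<bar>s\<bar> \<le> pi"
        using that L[of n] by (simp add: u_def field_simps)
      moreover have "0 \<le> u * \<bar>s\<bar>" using u by simp
      moreover have "cos (u * s) = cos (u * \<bar>s\<bar>)" by (cases "s \<ge> 0") simp_all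
      ultimately have "arccos (cos (u * s)) = u * \<bar>s\<bar>"
        using arccos_cos[of "u * \<bar>s\<bar>"] by metis
      with approx[of "cos (u * s)"] u show ?thesis
        by (simp add: p_def)
    qed
    ultimately show ?thesis by blast
  qed
  then obtain p where p: "\<And>n. cosine_poly (p n)" "\<And>n s. \<bar>p n s\<bar> \<le> 2"
    and near: "\<And>n s. \<bar>s\<bar> \<le> L n \<Longrightarrow> \<bar>g n (abs s) - p n s\<bar> < 1 / real (Suc n)"
    by metis
  have "(\<lambda>n. p n s) \<longlonglongrightarrow> indicator {-r..r} s" for s
  proof -
    have ev: "eventually (\<lambda>n. \<bar>p n s - indicator {-r..r} s\<bar> \<le> 1 / real (Suc n)) sequentially"
    proof -
      \<comment> \<open>From \<open>M\<close> on, \<open>\<bar>s\<bar>\<close> lies within the half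
        period and, if it exceeds \<open>r\<close>, beyond the end of the ramp. For
        \<open>\<bar>s\<bar> \<le> r\<close> the quotient is nonpositive (0 at equality, by division
        by zero) and imposes nothing.\<close>
      obtain M :: nat where M: "real M \<ge> max \<bar>s\<bar> (1 / (\<bar>s\<bar> - r))"
        using real_arch_simple by blast
      have "\<bar>p n s - indicator {-r..r} s\<bar> \<le> 1 / real (Suc n)" if n: "n \<ge> M" for n
      proof -
        have nM: "real (Suc n) \<ge> \<bar>s\<bar>" "real (Suc n) \<ge> 1 / (\<bar>s\<bar> - r)"
          using M n by auto
        have "\<bar>s\<bar> \<le> L n" using nM(1) r by (simp add: L_def)
        moreover have "g n \<bar>s\<bar> = indicator {-r..r} s"
        proof (cases "\<bar>s\<bar> \<le> r")
          case True
          then show ?thesis by (auto simp: g_def indicator_def min_def)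
        next
          case False
          then have "1 \<le> real (Suc n) * (\<bar>s\<bar> - r)"
            using nM(2) by (simp add: field_simps)
          with False show ?thesis by (auto simp: g_def indicator_def algebra_simps)
        qed
        ultimately show ?thesis using near[of s n] by (simp add: abs_minus_commute)
      qed
      then show ?thesis by (auto simp: eventually_sequentially)
    qed
    have "(\<lambda>n. 1 / real (Suc n)) \<longlonglongrightarrow> 0"
      using LIMSEQ_inverse_real_of_nat by (simp add: inverse_eq_divide)
    then have "(\<lambda>n. p n s - indicator {-r..r} s) \<longlonglongrightarrow> 0"
      by (rule Lim_null_comparison[rotated]) (use ev in simp)
    then show ?thesis by (simp add: LIM_zero_iff)
  qed
  with p that show thesis by blast
qed

section \<open>Polytopes and the cube\<close>

lemma std_gaussian_bounded_convergence:
  fixes f :: "nat \<Rightarrow> real ^ 'n \<Rightarrow> real"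
  assumes [measurable]: "\<And>n. f n \<in> borel_measurable borel"
    and bnd: "\<And>n x. \<bar>f n x\<bar> \<le> K" and lim: "\<And>x. (\<lambda>n. f n x) \<longlonglongrightarrow> g x"
  shows "(\<lambda>n. integral\<^sup>L std_gaussian (f n)) \<longlonglongrightarrow> integral\<^sup>L std_gaussian g"
proof (rule integral_dominated_convergence[where w = "\<lambda>_. K"])
  have "g \<in> borel_measurable borel"
    by (rule borel_measurable_LIMSEQ_real[OF lim]) simp
  then show "g \<in> borel_measurable std_gaussian" by measurable
qed (use bnd lim in auto)

text \<open>The inequality for products of cosine sums passes to the limit: these converge pointwise
  to the indicator and are bounded by \<open>2 ^ CARD('n)\<close>, so all integrals
  converge.\<close>

lemma covariance_cube_le:
  fixes h :: "real ^ 'n \<Rightarrow> real" and r :: real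
  defines "C \<equiv> (indicator (cube r) :: real ^ 'n \<Rightarrow> real)"
  assumes r: "r > 0" and B: "orthonormal B"
    and [measurable]: "h \<in> borel_measurable borel" and h: "\<And>x. 0 \<le> h x" "\<And>x. h x \<le> 1"
    and inv: "\<And>x q. (\<And>v. v \<in> B \<Longrightarrow> v \<bullet> q = 0) \<Longrightarrow> h (x + q) = h x"
  shows "((\<integral>x. C x * h x \<partial>std_gaussian) - integral\<^sup>L std_gaussian C * integral\<^sup>L std_gaussian h)\<^sup>2
    \<le> real (card B) / real CARD('n) / 4 * ((\<integral>x. (C x)\<^sup>2 \<partial>std_gaussian) - (integral\<^sup>L std_gaussian C)\<^sup>2)"
proof -
  obtain p where p: "\<And>k::nat. cosine_poly (p k)" "\<And>k s. \<bar>p k s\<bar> \<le> 2"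
    "\<And>s. (\<lambda>k. p k s) \<longlonglongrightarrow> indicator {-r..r} s"
    using cosine_poly_approx_interval[OF r] by blast
  define F where "F k x = (\<Prod>i\<in>UNIV. p k (x $ i))" for k and x :: "real ^ 'n"
  have [measurable]: "p k \<in> borel_measurable borel" for k
  proof -
    obtain N \<alpha> \<kappa> where "\<And>s. p k s = (\<Sum>j<N::nat. \<alpha> j * cos (\<kappa> j * s))"
      using p(1)[of k] unfolding cosine_poly_def by blast
    then have "p k = (\<lambda>s. \<Sum>j<N. \<alpha> j * cos (\<kappa> j * s))" by (simp add: fun_eq_iff)
    then show ?thesis by simp
  qed
  have [measurable]: "F k \<in> borel_measurable borel" for k
    unfolding F_def[abs_def] by measurable
  have F_le: "\<bar>F k x\<bar> \<le> 2 ^ CARD('n)" for k x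
    unfolding F_def abs_prod using prod_mono[of UNIV "\<lambda>i. \<bar>p k (x $ i)\<bar>" "\<lambda>_. 2"] p(2) by simp
  have F_lim: "(\<lambda>k. F k x) \<longlonglongrightarrow> C x" for x
  proof -
    have "(\<Prod>i\<in>UNIV. indicator {-r..r} (x $ i)) = C x"
      by (simp add: C_def cube_def indicator_def prod.If_cases)
    then show ?thesis
      using tendsto_prod[of UNIV "\<lambda>i k. p k (x $ i)" "\<lambda>i. indicator {-r..r} (x $ i)" sequentially] p(3)
      by (simp add: F_def)
  qed
  have le: "((\<integral>x. F k x * h x \<partial>std_gaussian) - integral\<^sup>L std_gaussian (F k) * integral\<^sup>L std_gaussian h)\<^sup>2
    \<le> real (card B) / real CARD('n) / 4 * ((\<integral>x. (F k x)\<^sup>2 \<partial>std_gaussian) - (integral\<^sup>L std_gaussian (F k))\<^sup>2)" for k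
  proof -
    obtain I :: "('n \<Rightarrow> nat \<times> real) set" and b w
      where fam: "hyperoctahedral_family I b w"
        and F: "\<And>x :: real ^ 'n. (\<Prod>i\<in>UNIV. p k (x $ i)) = (\<Sum>\<beta>\<in>I. w \<beta> * cos (b \<beta> \<bullet> x))"
      by (rule prod_cosine_poly[OF p(1)[of k], where 'n = 'n]) (rule that)
    have Fk: "F k = (\<lambda>x. \<Sum>\<beta>\<in>I. w \<beta> * cos (b \<beta> \<bullet> x))"
      by (simp add: F_def F fun_eq_iff)
    show ?thesis
      unfolding Fk by (rule hyperoctahedral_family.covariance_cosine_sum_le[OF fam B _ h inv]) simp_all
  qed
  have lim1: "(\<lambda>k. integral\<^sup>L std_gaussian (F k)) \<longlonglongrightarrow> integral\<^sup>L std_gaussian C"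
    by (rule std_gaussian_bounded_convergence[OF _ F_le F_lim]) simp
  have lim2: "(\<lambda>k. \<integral>x. (F k x)\<^sup>2 \<partial>std_gaussian) \<longlonglongrightarrow> (\<integral>x. (C x)\<^sup>2 \<partial>std_gaussian)"
  proof (rule std_gaussian_bounded_convergence)
    show "\<bar>(F k x)\<^sup>2\<bar> \<le> (2 ^ CARD('n))\<^sup>2" for k x
      using power_mono[OF F_le, of k x 2] by simp
  qed (auto intro!: tendsto_power F_lim)
  have lim3: "(\<lambda>k. \<integral>x. F k x * h x \<partial>std_gaussian) \<longlonglongrightarrow> (\<integral>x. C x * h x \<partial>std_gaussian)"
  proof (rule std_gaussian_bounded_convergence)
    show "\<bar>F k x * h x\<bar> \<le> 2 ^ CARD('n)" for k x
      using mult_mono[OF F_le[of k x], of "\<bar>h x\<bar>" 1] h[of x] by (simp add: abs_mult)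
  qed (auto intro!: tendsto_mult F_lim)
  show ?thesis
    by (rule LIMSEQ_le[OF tendsto_power[OF tendsto_diff[OF lim3 tendsto_mult[OF lim1 tendsto_const]]]
          tendsto_mult[OF tendsto_const tendsto_diff[OF lim2 tendsto_power[OF lim1]]]])
      (use le in blast)
qed

section \<open>Halfspaces and the final estimate\<close>

lemma halfspace_translate:
  assumes "is_halfspace H"
  obtains a where "\<And>x q. a \<bullet> q = 0 \<Longrightarrow> x + q \<in> H \<longleftrightarrow> x \<in> H"
proof -
  obtain a b where "H = {x. a \<bullet> x \<le> b} \<or> H = {x. a \<bullet> x < b}"
    using assms unfolding is_halfspace_def by blast
  then show thesis
    by (intro that[of a]) (auto simp: inner_add_right)
qed

lemma borel_halfspace: "is_halfspace H \<Longrightarrow> H \<in> sets borel"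
  by (auto simp: is_halfspace_def)

theorem theorem5:
  fixes P :: "(real ^ 'n) set" and r :: real and m :: nat
  assumes "r > 0"
    and "measure std_gaussian (cube r :: (real ^ 'n) set) = 1 / 2"
    and "is_intersection_of_halfspaces m P"
  shows "dist_G P (cube r) \<ge> 1 / 2 - sqrt (real m * ln 2 / (2 * real CARD('n)))
    \<and> (\<forall>\<epsilon>::real. dist_G P (cube r) \<le> \<epsilon> \<and> \<epsilon> < 1 / 2 \<longrightarrow>
          real m \<ge> 2 * (1 / 2 - \<epsilon>)\<^sup>2 / ln 2 * real CARD('n))"
proof -
  let ?C = "cube r :: (real ^ 'n) set" and ?\<gamma> = "measure (std_gaussian :: (real ^ 'n) measure)"
  let ?n = "real CARD('n)"
  obtain H where H: "\<And>i. i < m \<Longrightarrow> is_halfspace (H i)" and P: "P = (\<Inter>i<m. H i)"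
    using assms(3) unfolding is_intersection_of_halfspaces_def by blast
  have "\<forall>i\<in>{..<m}. \<exists>a. \<forall>x q. a \<bullet> q = 0 \<longrightarrow> (x + q \<in> H i \<longleftrightarrow> x \<in> H i)"
    using H halfspace_translate by (metis lessThan_iff)
  then obtain a where a: "\<And>i x q. i < m \<Longrightarrow> a i \<bullet> q = 0 \<Longrightarrow> x + q \<in> H i \<longleftrightarrow> x \<in> H i"
    unfolding bchoice_iff by auto
  \<comment> \<open>The span of the normals; dependent or repeated normals only make its dimension
    smaller than \<open>m\<close>.\<close>
  define V where "V = span (a ` {..<m})"
  obtain B where B: "B \<subseteq> V" "pairwise orthogonal B" "\<And>x. x \<in> B \<Longrightarrow> norm x = 1"
      "independent B" "card B = dim V" "span B = V"
    using orthonormal_basis_subspace[of V] unfolding V_def by (metis subspace_span)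
  have onb: "orthonormal B"
    using B independent_imp_finite by (simp add: orthonormal_def)
  have card_B: "card B \<le> m"
    using dim_le_card'[of "a ` {..<m}"] card_image_le[of "{..<m}" a] B(5) by (simp add: V_def)
  have P_meas [measurable]: "P \<in> sets borel"
  \<comment> \<open>The empty intersection is \<open>UNIV\<close>; the closure rule for
    intersections asks for a nonempty index set.\<close>
  proof (cases "m = 0")
    case False
    then show ?thesis unfolding P using H borel_halfspace by (intro sets.countable_INT') auto
  qed (simp add: P)
  have C_meas [measurable]: "?C \<in> sets borel"
    unfolding cube_def by measurable
  \<comment> \<open>A vector orthogonal to \<open>B\<close> is orthogonal to every normal
    \<open>a i\<close>, so translating by it respects each halfspace.\<close>
  have inv: "indicator P (x + q) = (indicator P x :: real)" if q: "\<And>v. v \<in> B \<Longrightarrow> v \<bullet> q = 0" for x q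
  proof -
    have "a i \<bullet> q = 0" if "i < m" for i
    proof -
      have "a i \<in> span B" using that B(6) by (auto simp: V_def intro: span_base)
      then show ?thesis
        using orthogonal_to_span[of "a i" B q] q by (simp add: orthogonal_def inner_commute)
    qed
    then show ?thesis using a by (simp add: P indicator_def)
  qed
  \<comment> \<open>The covariance of the two indicators, since the cube has measure 1/2.\<close>
  define X where "X = ?\<gamma> (P \<inter> ?C) - ?\<gamma> P / 2"
  have CP: "(\<integral>x. indicator ?C x * indicator P x \<partial>std_gaussian) = ?\<gamma> (P \<inter> ?C)"
    by (simp add: Int_commute flip: indicator_inter_arith)
  have CC: "(\<integral>x. (indicator ?C x)\<^sup>2 \<partial>std_gaussian) = (1 / 2 :: real)"
    by (simp add: power2_eq_square assms(2) flip: indicator_inter_arith)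
  \<comment> \<open>The last factor is the variance 1/2 - 1/4 of the indicator of the cube.\<close>
  have "X\<^sup>2 \<le> real (card B) / ?n / 4 * (1 / 4)"
    using covariance_cube_le[OF assms(1) onb _ _ _ inv]
    by (simp add: CP CC assms(2) X_def power_divide)
  also have "\<dots> \<le> real m / ?n / 4 * (1 / 4)"
    using card_B by (intro mult_right_mono divide_right_mono) auto
  finally have X: "(2 * X)\<^sup>2 \<le> real m * (1 / 4) / ?n"
    by (simp add: power_mult_distrib)
  \<comment> \<open>Here 1/4 is weakened to \<open>ln 2 / 2\<close> to reach the stated
    constant.\<close>
  also have "\<dots> \<le> real m * (ln 2 / 2) / ?n"
    using ln2_ge_two_thirds by (intro divide_right_mono mult_left_mono) auto
  finally have bound: "2 * X \<le> sqrt (real m * ln 2 / (2 * ?n))"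
    by (intro real_le_rsqrt) simp
  have "dist_G P ?C = ?\<gamma> (P - ?C) + ?\<gamma> (?C - P)"
    unfolding dist_G_def by (rule std_gaussian.finite_measure_Union) auto
  \<comment> \<open>The two differences add up to
    \<open>?\<gamma> P + 1 / 2 - 2 * ?\<gamma> (P \<inter> ?C)\<close>.\<close>
  also have "\<dots> = 1 / 2 - 2 * X"
    by (simp add: std_gaussian.finite_measure_Diff' Int_commute assms(2) X_def)
  finally have lower: "1 / 2 - sqrt (real m * ln 2 / (2 * ?n)) \<le> dist_G P ?C"
    using bound by simp
  moreover have "real m \<ge> 2 * (1 / 2 - \<epsilon>)\<^sup>2 / ln 2 * ?n" if "dist_G P ?C \<le> \<epsilon>" "\<epsilon> < 1 / 2" for \<epsilon>
  proof -
    \<comment> \<open>The gap \<open>1 / 2 - \<epsilon>\<close> is positive and at most the root, so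
      squaring preserves the order.\<close>
    have "(1 / 2 - \<epsilon>)\<^sup>2 \<le> (sqrt (real m * ln 2 / (2 * ?n)))\<^sup>2"
      using lower that by (intro power_mono) auto
    also have "\<dots> = real m * ln 2 / (2 * ?n)"
      by simp
    finally show ?thesis
      by (simp add: field_simps)
  qed
  ultimately show ?thesis by blast
qed

end
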